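(* Let $(x_k)_{k\ge0}$ be generated by the BAXG method (described in the context). Then for every $k\ge1$ and every $y\in\mathcal X$, $$g(x_k)-g(y)+\langle Qy,x_k-y\rangle\le\frac{4L\|y-x_0\|^2}{k^2}.$$
   Context: Setting. $\|\cdot\|$ is the Euclidean norm. $\mathcal V\subset\mathbb R^n$ is a nonempty closed convex set, $\mathcal X=\mathbb R^d\times\mathcal V$, $x=(w,v)\in\mathcal X$; $f$ on $\mathbb R^d$ and $h$ on $\mathcal V$ are convex and differentiable, $g(x)=f(w)+h(v)$. For all $x,y\in\mathcal X$: $g(x)\ge g(y)+\langle\nabla g(y),x-y\rangle$ and $\|\nabla g(x)-\nabla g(y)\|\le L\|x-y\|$, with $L>0$. $A\in\mathbb R^{d\times n}$ has full column rank with least and largest singular values $\sigma_{\min}>0$, $\sigma_{\max}>0$. $Q=\begin{pmatrix}0&A\\-A^T&0\end{pmatrix}$. BAXG method. $A_k=\frac{k^2}{4L}$ for $k\ge0$ and $a_k=A_k-A_{k-1}$ for $k\ge1$. Start with $x_0=z_0\in\mathcal X$. For $k=1,2,\dots$: (a) $\hat x_{k-1}=\frac{A_{k-1}}{A_k}x_{k-1}+\frac{a_k}{A_k}z_{k-1}$. (b) Find (by a subroutine) $\hat z_k\in\mathcal X$ such that for all $z\in\mathcal X$: $a_k\langle\nabla g(\hat x_{k-1})+Qz_{k-1}+(Q+\frac{2}{a_k}I)(\hat z_k-z_{k-1}),\hat z_k-z\rangle-\frac12(\|\hat z_k-z_{k-1}\|^2+\|\hat z_k-z\|^2)\le0$.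 (c) $x_k=\hat x_{k-1}+\frac{a_k}{A_k}(\hat z_k-z_{k-1})$. (d) $z_k=\arg\min_{x\in\mathcal X}\{\sum_{i=1}^k a_i(g(x_i)+\langle\nabla g(x_i),x-x_i\rangle+\langle Q\hat z_i,x-y\rangle)+\|x-x_0\|^2\}$ (the minimizer does not depend on $y\in\mathcal X$, which only contributes an additive constant). *)

theory Defs
  imports "HOL-Analysis.Analysis"
begin

text \<open>The skew-symmetric block matrix with rows \<open>(0, A)\<close> and \<open>(- transpose A, 0)\<close>, acting on the
  Euclidean product space of pairs \<open>(w, v)\<close>.\<close>

definition skew_block ::
  "real ^ 'n ^ 'd \<Rightarrow> (real ^ 'd) \<times> (real ^ 'n) \<Rightarrow> (real ^ 'd) \<times> (real ^ 'n)"
where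
  "skew_block A x = (A *v snd x, - (transpose A *v fst x))"

definition baxg_A :: "real \<Rightarrow> nat \<Rightarrow> real"
where
  "baxg_A L k = (real k)\<^sup>2 / (4 * L)"

definition baxg_a :: "real \<Rightarrow> nat \<Rightarrow> real"
where \<comment> \<open>only meaningful for \<open>k \<ge> 1\<close>\<close>
  "baxg_a L k = baxg_A L k - baxg_A L (k - 1)"

definition baxg_objective ::
  "real \<Rightarrow> ('a::real_inner \<Rightarrow> real) \<Rightarrow> ('a \<Rightarrow> 'a) \<Rightarrow> ('a \<Rightarrow> 'a)
    \<Rightarrow> (nat \<Rightarrow> 'a) \<Rightarrow> (nat \<Rightarrow> 'a) \<Rightarrow> nat \<Rightarrow> 'a \<Rightarrow> 'a \<Rightarrow> real"
where
  "baxg_objective L g grad_g Q x zhat k y u =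
     (\<Sum>i = 1..k. baxg_a L i *
        (g (x i) + grad_g (x i) \<bullet> (u - x i) + Q (zhat i) \<bullet> (u - y)))
     + (norm (u - x 0))\<^sup>2"

text \<open>The sequences \<open>x\<close>, \<open>z\<close>, \<open>xhat\<close>, \<open>zhat\<close> form a run of the method on the feasible set \<open>X\<close>.
  Any inexact solution \<open>zhat k\<close> that passes the acceptance test is allowed. The value
  \<open>zhat 0\<close> is never used. The reference point \<open>y\<close> in the last clause is immaterial
  (lemma \<open>baxg_arg_min_indep\<close> below).\<close>

definition baxg_run ::
  "real \<Rightarrow> 'a::real_inner set \<Rightarrow> ('a \<Rightarrow> real) \<Rightarrow> ('a \<Rightarrow> 'a) \<Rightarrow> ('a \<Rightarrow> 'a)
    \<Rightarrow> (nat \<Rightarrow> 'a) \<Rightarrow> (nat \<Rightarrow> 'a) \<Rightarrow> (nat \<Rightarrow> 'a) \<Rightarrow> (nat \<Rightarrow> 'a) \<Rightarrow> bool"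
where
  "baxg_run L X g grad_g Q x z xhat zhat \<longleftrightarrow>
     x 0 \<in> X \<and> z 0 = x 0 \<and>
     (\<forall>k\<ge>1.
        xhat (k - 1) = (baxg_A L (k - 1) / baxg_A L k) *\<^sub>R x (k - 1)
                       + (baxg_a L k / baxg_A L k) *\<^sub>R z (k - 1) \<and>
        zhat k \<in> X \<and>
        (\<forall>u\<in>X.
           baxg_a L k *
             ((grad_g (xhat (k - 1)) + Q (z (k - 1))
                + (Q (zhat k - z (k - 1)) + (2 / baxg_a L k) *\<^sub>R (zhat k - z (k - 1))))
              \<bullet> (zhat k - u))
           - 1 / 2 * ((norm (zhat k - z (k - 1)))\<^sup>2 + (norm (zhat k - u))\<^sup>2) \<le> 0) \<and>
        x k = xhat (k - 1) + (baxg_a L k / baxg_A L k) *\<^sub>R (zhat k - z (k - 1)) \<and>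
        (\<forall>y\<in>X. is_arg_min (baxg_objective L g grad_g Q x zhat k y) (\<lambda>u. u \<in> X) (z k)))"

lemma baxg_objective_diff:
  "baxg_objective L g grad_g Q x zhat k y u =
     baxg_objective L g grad_g Q x zhat k y' u
     + (\<Sum>i = 1..k. baxg_a L i * (Q (zhat i) \<bullet> (y' - y)))"
  unfolding baxg_objective_def
  by (simp add: sum.distrib[symmetric] algebra_simps)

lemma baxg_arg_min_indep:
  "is_arg_min (baxg_objective L g grad_g Q x zhat k y) P u \<longleftrightarrow>
   is_arg_min (baxg_objective L g grad_g Q x zhat k y') P u"
  unfolding is_arg_min_def
  by (subst (1 2) baxg_objective_diff[of _ _ _ _ _ _ _ y _ y']) simp

end

theory Submission
  imports Defs
begin

text \<open>
  The proof is an estimate-sequence argument. Write \<open>\<psi>\<^sub>k\<close> for the objective that \<open>z k\<close> minimizes,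
  with reference point \<open>y\<close>. Its linear parts are tangents of \<open>g\<close>, so
  \<open>\<psi>\<^sub>k y \<le> A\<^sub>k * g y + (norm (y - x 0))\<^sup>2\<close>, the coupling terms vanishing at \<open>u = y\<close>. From below, the
  claim to be carried along is
  \<open>\<psi>\<^sub>k (z k) \<ge> A\<^sub>k * g (x k) + (\<Sum>i = 1..k. a\<^sub>i * (Q (zhat i) \<bullet> (zhat i - y)))\<close>.
  Because \<open>Q\<close> is skew, each summand equals \<open>a\<^sub>i * (Q y \<bullet> (zhat i - y))\<close>, and because \<open>x k\<close> is the
  average of the \<open>zhat i\<close> with weights \<open>a\<^sub>i / A\<^sub>k\<close>, the sum is \<open>A\<^sub>k * (Q y \<bullet> (x k - y))\<close>. Comparing
  both bounds through \<open>\<psi>\<^sub>k (z k) \<le> \<psi>\<^sub>k y\<close> and dividing by \<open>A\<^sub>k = k\<^sup>2 / (4 * L)\<close> gives the rate.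

  The lower bound follows by induction. The quadratic term makes \<open>\<psi>\<^sub>k\<close> grow by
  \<open>(norm (u - z k))\<^sup>2\<close> away from its minimizer (\<open>quadratic_growth_at_minimizer\<close>). After bounding
  \<open>g (x (k - 1))\<close> below by the tangent at \<open>x k\<close> and cancelling with
  \<open>A\<^sub>k *\<^sub>R x k = A\<^sub>k\<^sub>-\<^sub>1 *\<^sub>R x (k - 1) + a\<^sub>k *\<^sub>R zhat k\<close>, the induction step reduces to
  \<open>(norm (z k - z (k - 1)))\<^sup>2 + a\<^sub>k * ((grad_g (x k) + Q (zhat k)) \<bullet> (z k - zhat k)) \<ge> 0\<close>.
  The acceptance test at \<open>u = z k\<close> yields this with \<open>grad_g (xhat (k - 1))\<close> in place of
  \<open>grad_g (x k)\<close> and a surplus of half the squared norms of \<open>p = zhat k - z (k - 1)\<close> and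
  \<open>q = zhat k - z k\<close>. The extrapolation \<open>x k - xhat (k - 1) = (a\<^sub>k / A\<^sub>k) *\<^sub>R p\<close> bounds the
  error of that replacement by \<open>L * a\<^sub>k\<^sup>2 / A\<^sub>k * norm p * norm q\<close>, and
  \<open>L * a\<^sub>k\<^sup>2 \<le> A\<^sub>k\<close> is exactly what the choice of the step sizes provides.
\<close>

section \<open>Skew block matrices and quadratic minimization\<close>

lemma linear_skew_block: "linear (skew_block A)"
  by (rule linearI)
    (simp_all add: skew_block_def matrix_vector_right_distrib
      matrix_vector_mult_scaleR)

lemma skew_block_inner_self: "skew_block A u \<bullet> u = 0"
  by (simp add: skew_block_def inner_prod_def dot_lmul_matrix[symmetric]
      transpose_matrix_vector inner_commute)

text \<open>Along the segment from the minimizer \<open>z\<close> to \<open>u\<close> the function is \<open>t * m + t\<^sup>2 * (norm (u - z))\<^sup>2\<close>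
  up to a constant. Minimality forces the slope \<open>m\<close> at \<open>z\<close> to be nonnegative, which leaves the full
  quadratic term at \<open>t = 1\<close>.\<close>

lemma quadratic_growth_at_minimizer:
  fixes \<phi> :: "'a::real_inner \<Rightarrow> real"
  assumes \<phi>: "\<And>u. \<phi> u = c + b \<bullet> u + (norm (u - x0))\<^sup>2"
    and "convex X" and min: "is_arg_min \<phi> (\<lambda>u. u \<in> X) z" and u: "u \<in> X"
  shows "\<phi> u \<ge> \<phi> z + (norm (u - z))\<^sup>2"
proof -
  define m where "m = b \<bullet> (u - z) + 2 * ((z - x0) \<bullet> (u - z))"
  have along: "\<phi> (z + t *\<^sub>R (u - z)) = \<phi> z + t * m + t\<^sup>2 * (norm (u - z))\<^sup>2" for t
    unfolding \<phi> m_def power2_norm_eq_inner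
    by (simp add: inner_simps inner_commute algebra_simps power2_eq_square)
  have z: "z \<in> X" and le: "\<phi> z \<le> \<phi> v" if "v \<in> X" for v
    using min that by (auto simp: is_arg_min_linorder)
  have slope: "0 \<le> m + t * (norm (u - z))\<^sup>2" if t: "0 < t" "t \<le> 1" for t
  proof -
    have "z + t *\<^sub>R (u - z) \<in> X"
      using convexD_alt[OF \<open>convex X\<close> z[OF u] u, of t] t by (simp add: algebra_simps)
    then have "0 \<le> t * m + t\<^sup>2 * (norm (u - z))\<^sup>2"
      using le along by fastforce
    also have "\<dots> = t * (m + t * (norm (u - z))\<^sup>2)"
      by (simp add: algebra_simps power2_eq_square)
    finally show ?thesis
      using t by (simp add: zero_le_mult_iff)
  qed
  have "((\<lambda>t. m + t * (norm (u - z))\<^sup>2) \<longlongrightarrow> m + 0 * (norm (u - z))\<^sup>2) (at_right 0)"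
    by (intro tendsto_intros)
  moreover have "\<forall>\<^sub>F t in at_right 0. 0 \<le> m + t * (norm (u - z))\<^sup>2"
    unfolding eventually_at_right_field by (rule exI[of _ 1]) (auto intro: slope)
  ultimately have "0 \<le> m"
    using tendsto_lowerbound by fastforce
  then show ?thesis
    using along[of 1] by simp
qed

section \<open>Weights and feasibility of the iterates\<close>

lemma baxg_a_eq: "k \<ge> 1 \<Longrightarrow> baxg_a L k = (2 * real k - 1) / (4 * L)"
  by (simp add: baxg_a_def baxg_A_def of_nat_diff diff_divide_distrib[symmetric]
      power2_eq_square algebra_simps)

text \<open>Here \<open>skew_Q\<close> states skew-symmetry of \<open>Q\<close> in its quadratic form; by polarization this is
  \<open>Q u \<bullet> v = - (Q v \<bullet> u)\<close>.\<close>

locale baxg_iteration =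
  fixes L :: real and X :: "'a::real_inner set" and g :: "'a \<Rightarrow> real" and grad_g Q :: "'a \<Rightarrow> 'a"
    and x z xhat zhat :: "nat \<Rightarrow> 'a"
  assumes L_pos: "L > 0"
    and convex_X: "convex X"
    and tangent: "\<And>u v. u \<in> X \<Longrightarrow> v \<in> X \<Longrightarrow> g u \<ge> g v + grad_g v \<bullet> (u - v)"
    and lipschitz: "\<And>u v. u \<in> X \<Longrightarrow> v \<in> X \<Longrightarrow> norm (grad_g u - grad_g v) \<le> L * norm (u - v)"
    and linear_Q: "linear Q"
    and skew_Q: "\<And>u. Q u \<bullet> u = 0"
    and run: "baxg_run L X g grad_g Q x z xhat zhat"
begin

abbreviation "wA \<equiv> baxg_A L"
abbreviation "wa \<equiv> baxg_a L"
abbreviation "\<psi> \<equiv> baxg_objective L g grad_g Q x zhat"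

lemma wA_nonneg: "0 \<le> wA k"
  using L_pos by (simp add: baxg_A_def)

lemma wA_pos: "k \<ge> 1 \<Longrightarrow> 0 < wA k"
  using L_pos by (simp add: baxg_A_def)

lemma wa_pos: "k \<ge> 1 \<Longrightarrow> 0 < wa k"
  using L_pos by (simp add: baxg_a_eq)

lemma wA_Suc: "wA (Suc k) = wA k + wa (Suc k)"
  by (simp add: baxg_a_def)

lemma sum_wa: "(\<Sum>i = 1..k. wa i) = wA k"
proof (induction k)
  case 0
  show ?case by (simp add: baxg_A_def)
next
  case (Suc k)
  then show ?case by (simp add: wA_Suc)
qed

text \<open>After clearing denominators this reads \<open>(2 * k - 1)\<^sup>2 \<le> (2 * k)\<^sup>2\<close>.\<close>

lemma step_size_bound:
  assumes "k \<ge> 1"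
  shows "L * (wa k)\<^sup>2 / wA k \<le> 1"
proof -
  have "(2 * real k - 1)\<^sup>2 \<le> (2 * real k)\<^sup>2"
    using assms by (intro power_mono) auto
  then show ?thesis
    using assms L_pos
    by (simp add: baxg_a_eq baxg_A_def power2_eq_square field_simps)
qed

lemma skew_Q_swap: "Q u \<bullet> (u - y) = Q y \<bullet> (u - y)"
proof -
  have "(Q u - Q y) \<bullet> (u - y) = 0"
    using skew_Q[of "u - y"] by (simp add: linear_diff[OF linear_Q])
  then show ?thesis
    by (simp add: inner_diff_left)
qed

lemma start: "x 0 \<in> X" "z 0 = x 0"
  using run by (auto simp: baxg_run_def)

lemma zhat_in_X: "zhat (Suc k) \<in> X"
  using run by (auto simp: baxg_run_def)

lemma xhat_eq: "xhat k = (wA k / wA (Suc k)) *\<^sub>R x k + (wa (Suc k) / wA (Suc k)) *\<^sub>R z k"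
  using run unfolding baxg_run_def by (metis diff_Suc_1 le_add1 plus_1_eq_Suc)

lemma x_Suc: "x (Suc k) = xhat k + (wa (Suc k) / wA (Suc k)) *\<^sub>R (zhat (Suc k) - z k)"
  using run unfolding baxg_run_def by (metis diff_Suc_1 le_add1 plus_1_eq_Suc)

text \<open>For \<open>k = 0\<close> the objective is the squared distance to \<open>x 0 = z 0\<close>, so the minimizing property
  extends to the starting point and the induction below needs no special first step.\<close>

lemma z_minimizes:
  assumes "y \<in> X"
  shows "is_arg_min (\<psi> k y) (\<lambda>u. u \<in> X) (z k)"
proof (cases "k = 0")
  case True
  then show ?thesis
    using start by (simp add: is_arg_min_linorder baxg_objective_def)
next
  case False
  then show ?thesis
    using run assms by (simp add: baxg_run_def)
qed

lemma z_in_X: "z k \<in> X"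
  using z_minimizes[OF start(1)] by (simp add: is_arg_min_def)

lemma convex_combination_in_X:
  assumes "u \<in> X" "v \<in> X"
  shows "(wA k / wA (Suc k)) *\<^sub>R u + (wa (Suc k) / wA (Suc k)) *\<^sub>R v \<in> X"
proof -
  have "wA k / wA (Suc k) + wa (Suc k) / wA (Suc k) = 1"
    using wA_pos[of "Suc k"] by (simp add: wA_Suc add_divide_distrib[symmetric])
  then show ?thesis
    using assms wA_nonneg wa_pos[of "Suc k"] by (intro convexD[OF convex_X]) simp_all
qed

lemma x_Suc_average:
  "x (Suc k) = (wA k / wA (Suc k)) *\<^sub>R x k + (wa (Suc k) / wA (Suc k)) *\<^sub>R zhat (Suc k)"
  by (simp add: x_Suc xhat_eq algebra_simps)

lemma x_in_X: "x k \<in> X"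
  by (induction k) (use start in \<open>simp_all add: x_Suc_average convex_combination_in_X zhat_in_X\<close>)

lemma xhat_in_X: "xhat k \<in> X"
  unfolding xhat_eq by (intro convex_combination_in_X x_in_X z_in_X)

lemma weighted_x_Suc: "wA (Suc k) *\<^sub>R x (Suc k) = wA k *\<^sub>R x k + wa (Suc k) *\<^sub>R zhat (Suc k)"
  using wA_pos[of "Suc k"] by (simp add: x_Suc_average scaleR_add_right)

lemma weighted_x_eq_sum: "wA k *\<^sub>R x k = (\<Sum>i = 1..k. wa i *\<^sub>R zhat i)"
proof (induction k)
  case 0
  show ?case by (simp add: baxg_A_def)
next
  case (Suc k)
  then show ?case by (simp add: weighted_x_Suc)
qed

section \<open>Lower bound for the estimate sequence\<close>

lemma objective_growth:
  assumes "y \<in> X" "u \<in> X"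
  shows "\<psi> k y u \<ge> \<psi> k y (z k) + (norm (u - z k))\<^sup>2"
proof (rule quadratic_growth_at_minimizer[OF _ convex_X z_minimizes[OF assms(1)] assms(2)])
  show "\<psi> k y v =
      (\<Sum>i = 1..k. wa i * (g (x i) - grad_g (x i) \<bullet> x i - Q (zhat i) \<bullet> y))
      + (\<Sum>i = 1..k. wa i *\<^sub>R (grad_g (x i) + Q (zhat i))) \<bullet> v + (norm (v - x 0))\<^sup>2" for v
    unfolding baxg_objective_def
    by (simp add: inner_sum_left sum.distrib[symmetric] inner_simps algebra_simps)
qed

text \<open>With \<open>p\<close> and \<open>q\<close> as below, \<open>(norm (p - q))\<^sup>2\<close> absorbs the term \<open>2 * (p \<bullet> q)\<close> of the acceptance
  test and leaves at least \<open>((norm p)\<^sup>2 + (norm q)\<^sup>2) / 2 - norm p * norm q \<ge> 0\<close> once the change of gradient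
  has been paid for.\<close>

lemma step_inequality:
  "0 \<le> (norm (z (Suc k) - z k))\<^sup>2
      + wa (Suc k) * ((grad_g (x (Suc k)) + Q (zhat (Suc k))) \<bullet> (z (Suc k) - zhat (Suc k)))"
proof -
  define a p q where "a = wa (Suc k)" and "p = zhat (Suc k) - z k"
    and "q = zhat (Suc k) - z (Suc k)"
  define G where "G = grad_g (xhat k) + Q (zhat (Suc k))"
  define e where "e = grad_g (x (Suc k)) - grad_g (xhat k)"
  have a: "0 < a"
    using wa_pos[of "Suc k"] by (simp add: a_def)
  have "a * ((grad_g (xhat k) + Q (z k) + (Q p + (2 / a) *\<^sub>R p)) \<bullet> q)
      - 1 / 2 * ((norm p)\<^sup>2 + (norm q)\<^sup>2) \<le> 0"
    using run z_in_X[of "Suc k"] unfolding baxg_run_def a_def p_def q_def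
    by (metis diff_Suc_1 le_add1 plus_1_eq_Suc)
  moreover have "grad_g (xhat k) + Q (z k) + (Q p + (2 / a) *\<^sub>R p) = G + (2 / a) *\<^sub>R p"
    by (simp add: G_def p_def linear_diff[OF linear_Q])
  ultimately have "a * ((G + (2 / a) *\<^sub>R p) \<bullet> q) - 1 / 2 * ((norm p)\<^sup>2 + (norm q)\<^sup>2) \<le> 0"
    by metis
  then have test: "a * (G \<bullet> q) + 2 * (p \<bullet> q) \<le> ((norm p)\<^sup>2 + (norm q)\<^sup>2) / 2"
    using a by (simp add: inner_add_left algebra_simps)
  have "norm e \<le> L * norm (x (Suc k) - xhat k)"
    unfolding e_def by (intro lipschitz x_in_X xhat_in_X)
  also have "\<dots> = L * (a / wA (Suc k)) * norm p"
    using a wA_pos[of "Suc k"] by (simp add: x_Suc a_def p_def)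
  finally have "a * norm e \<le> a * (L * (a / wA (Suc k)) * norm p)"
    using a by (intro mult_left_mono) auto
  also have "\<dots> = L * a\<^sup>2 / wA (Suc k) * norm p"
    by (simp add: power2_eq_square)
  also have "\<dots> \<le> 1 * norm p"
    unfolding a_def by (intro mult_right_mono step_size_bound) auto
  finally have "a * norm e * norm q \<le> norm p * norm q"
    by (intro mult_right_mono) auto
  moreover have "a * (e \<bullet> q) \<le> a * (norm e * norm q)"
    using a by (intro mult_left_mono norm_cauchy_schwarz) auto
  moreover have "2 * (norm p * norm q) \<le> (norm p)\<^sup>2 + (norm q)\<^sup>2"
    using sum_squares_bound[of "norm p" "norm q"] by simp
  moreover have "(norm (p - q))\<^sup>2 = (norm p)\<^sup>2 + (norm q)\<^sup>2 - 2 * (p \<bullet> q)"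
    by (simp add: power2_norm_eq_inner inner_simps inner_commute)
  ultimately have "0 \<le> (norm (p - q))\<^sup>2 - a * ((G + e) \<bullet> q)"
    using test by (simp add: inner_add_left algebra_simps)
  moreover have "grad_g (x (Suc k)) + Q (zhat (Suc k)) = G + e"
    and "z (Suc k) - z k = p - q" and "z (Suc k) - zhat (Suc k) = - q"
    by (simp_all add: G_def e_def p_def q_def)
  ultimately show ?thesis
    by (simp add: a_def)
qed

lemma objective_lower_bound:
  assumes y: "y \<in> X"
  shows "wA k * g (x k) + (\<Sum>i = 1..k. wa i * (Q (zhat i) \<bullet> (zhat i - y))) \<le> \<psi> k y (z k)"
proof (induction k)
  case 0
  show ?case by (simp add: baxg_objective_def baxg_A_def)
next
  case (Suc k)
  let ?x = "x (Suc k)" and ?z = "z (Suc k)" and ?zh = "zhat (Suc k)" and ?a = "wa (Suc k)"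
  let ?S = "\<lambda>k. \<Sum>i = 1..k. wa i * (Q (zhat i) \<bullet> (zhat i - y))"
  have "wA k * (g ?x + grad_g ?x \<bullet> (x k - ?x)) \<le> wA k * g (x k)"
    by (intro mult_left_mono tangent x_in_X wA_nonneg)
  \<comment> \<open>The tangents at \<open>?x\<close> with weights \<open>wA k\<close> and \<open>?a\<close> meet in the average \<open>?x\<close>,
    which leaves only the difference between \<open>?z\<close> and \<open>?zh\<close>.\<close>
  moreover have "wA k * (grad_g ?x \<bullet> (x k - ?x)) + ?a * (grad_g ?x \<bullet> (?z - ?x))
      = ?a * (grad_g ?x \<bullet> (?z - ?zh))"
  proof -
    have "wA k *\<^sub>R (x k - ?x) + ?a *\<^sub>R (?z - ?x) = wA k *\<^sub>R x k + ?a *\<^sub>R ?z - wA (Suc k) *\<^sub>R ?x"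
      by (simp add: wA_Suc algebra_simps)
    also have "\<dots> = ?a *\<^sub>R (?z - ?zh)"
      by (simp add: weighted_x_Suc algebra_simps)
    finally show ?thesis
      by (metis inner_add_right inner_scaleR_right)
  qed
  moreover have "\<psi> (Suc k) y ?z = \<psi> k y ?z
      + ?a * (g ?x + grad_g ?x \<bullet> (?z - ?x) + Q ?zh \<bullet> (?z - y))"
    by (simp add: baxg_objective_def)
  moreover have "\<psi> k y (z k) + (norm (?z - z k))\<^sup>2 \<le> \<psi> k y ?z"
    by (intro objective_growth y z_in_X)
  moreover have "Q ?zh \<bullet> (?z - y) = Q ?zh \<bullet> (?z - ?zh) + Q ?zh \<bullet> (?zh - y)"
    by (simp add: inner_diff_right)
  moreover have "?S (Suc k) = ?S k + ?a * (Q ?zh \<bullet> (?zh - y))"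
    by simp
  ultimately show ?case
    using Suc.IH step_inequality[of k] unfolding wA_Suc by (simp add: inner_add_left algebra_simps)
qed

section \<open>Upper bound and convergence rate\<close>

lemma objective_upper_bound:
  assumes y: "y \<in> X"
  shows "\<psi> k y y \<le> wA k * g y + (norm (y - x 0))\<^sup>2"
proof -
  have "(\<Sum>i = 1..k. wa i * (g (x i) + grad_g (x i) \<bullet> (y - x i))) \<le> (\<Sum>i = 1..k. wa i * g y)"
    by (intro sum_mono mult_left_mono tangent y x_in_X) (simp add: less_imp_le wa_pos)
  then show ?thesis
    unfolding sum_distrib_right[symmetric] sum_wa by (simp add: baxg_objective_def)
qed

lemma coupling_sum:
  "(\<Sum>i = 1..k. wa i * (Q (zhat i) \<bullet> (zhat i - y))) = wA k * (Q y \<bullet> (x k - y))"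
proof -
  have "(\<Sum>i = 1..k. wa i * (Q (zhat i) \<bullet> (zhat i - y)))
      = (\<Sum>i = 1..k. wa i * (Q y \<bullet> (zhat i - y)))"
    by (simp only: skew_Q_swap)
  also have "\<dots> = Q y \<bullet> ((\<Sum>i = 1..k. wa i *\<^sub>R zhat i) - (\<Sum>i = 1..k. wa i) *\<^sub>R y)"
    by (simp add: inner_diff_right inner_sum_right right_diff_distrib
        sum_subtractf sum_distrib_right)
  also have "\<dots> = wA k * (Q y \<bullet> (x k - y))"
    unfolding sum_wa weighted_x_eq_sum[symmetric] scaleR_diff_right[symmetric] by simp
  finally show ?thesis .
qed

lemma gap_bound:
  assumes "y \<in> X" "k \<ge> 1"
  shows "g (x k) - g y + Q y \<bullet> (x k - y) \<le> 4 * L * (norm (y - x 0))\<^sup>2 / (real k)\<^sup>2"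
proof -
  have "\<psi> k y (z k) \<le> \<psi> k y y"
    using z_minimizes[OF assms(1)] assms(1) by (simp add: is_arg_min_linorder)
  then have "wA k * (g (x k) - g y + Q y \<bullet> (x k - y)) \<le> (norm (y - x 0))\<^sup>2"
    using objective_lower_bound[OF assms(1), of k, unfolded coupling_sum] objective_upper_bound[OF assms(1), of k]
    by (simp add: algebra_simps)
  then have "g (x k) - g y + Q y \<bullet> (x k - y) \<le> (norm (y - x 0))\<^sup>2 / wA k"
    using wA_pos[OF assms(2)] by (simp add: pos_le_divide_eq mult.commute)
  then show ?thesis
    by (simp add: baxg_A_def mult.commute)
qed

end

theorem theorem1:
  fixes f :: "real ^ 'd \<Rightarrow> real" and grad_f :: "real ^ 'd \<Rightarrow> real ^ 'd"
    and h :: "real ^ 'n \<Rightarrow> real" and grad_h :: "real ^ 'n \<Rightarrow> real ^ 'n"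
    and V :: "(real ^ 'n) set" and X :: "((real ^ 'd) \<times> (real ^ 'n)) set"
    and g :: "(real ^ 'd) \<times> (real ^ 'n) \<Rightarrow> real"
    and grad_g :: "(real ^ 'd) \<times> (real ^ 'n) \<Rightarrow> (real ^ 'd) \<times> (real ^ 'n)"
    and A :: "real ^ 'n ^ 'd" and Q :: "(real ^ 'd) \<times> (real ^ 'n) \<Rightarrow> (real ^ 'd) \<times> (real ^ 'n)"
    and L :: real
    and x z xhat zhat :: "nat \<Rightarrow> (real ^ 'd) \<times> (real ^ 'n)"
  assumes V: "V \<noteq> {}" "closed V" "convex V"
    and X: "X = UNIV \<times> V"
    and f_convex: "convex_on UNIV f"
    and f_grad: "\<forall>w. (f has_derivative (\<lambda>u. grad_f w \<bullet> u)) (at w)"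
    and h_convex: "convex_on V h"
    and h_grad: "\<forall>v\<in>V. (h has_derivative (\<lambda>u. grad_h v \<bullet> u)) (at v within V)"
    and g: "g = (\<lambda>(w, v). f w + h v)"
    and g_grad: "grad_g = (\<lambda>(w, v). (grad_f w, grad_h v))"
    and L_pos: "L > 0"
    and g_lower: "\<forall>x\<in>X. \<forall>y\<in>X. g x \<ge> g y + grad_g y \<bullet> (x - y)"
    and g_lipschitz: "\<forall>x\<in>X. \<forall>y\<in>X. norm (grad_g x - grad_g y) \<le> L * norm (x - y)"
    and A_rank: "rank A = CARD('n)"
    and Q: "Q = skew_block A"
    and run: "baxg_run L X g grad_g Q x z xhat zhat"
  shows "\<forall>k\<ge>1. \<forall>y\<in>X.
           g (x k) - g y + Q y \<bullet> (x k - y) \<le> 4 * L * (norm (y - x 0))\<^sup>2 / (real k)\<^sup>2"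
proof -
  have "convex X"
    unfolding X by (intro convex_Times convex_UNIV V)
  then interpret baxg_iteration L X g grad_g Q x z xhat zhat
    using L_pos g_lower g_lipschitz run
    by (intro baxg_iteration.intro) (auto simp: Q linear_skew_block skew_block_inner_self)
  show ?thesis
    by (blast intro: gap_bound)
qed

end
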